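(* Let $X$ be a non-empty set, and let $S\subseteq\mathrm{Der}(X)$ be non-empty. Then the following hold. (a) If each $s\in S$ has no infinite cycles, then the connectivity relation for $\overrightarrow{\mathrm{DA}}(X,S)$ is an equivalence relation on $X$. (b) If the connectivity relation for $\overrightarrow{\mathrm{DA}}(X,S)$ is an equivalence relation, then the equivalence classes are the orbits of $\langle S\rangle$ on $X$. Moreover, for each $\langle S\rangle$-orbit $X'$, the restriction $S':=S|_{X'}=\{s|_{X'}: s\in S\}$ satisfies $S'\subseteq\mathrm{Der}(X')$, and the connected component on $X'$ is $\overrightarrow{\mathrm{DA}}(X',S')$. (c) If $\Gamma$ is a simple digraph (with non-empty vertex set) for which the connectivity relation is an equivalence relation, then $\Gamma$ is a derangement action digraph if and only if each connected component of $\Gamma$ is a derangement action digraph.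
   Context: For a set $X$, $\mathrm{Sym}(X)$ is the group of all permutations of $X$, acting on the right: $x^s$ is the image of $x$ under $s$, and $x^{st}=(x^s)^t$. A derangement of $X$ is a permutation of $X$ with no fixed points; $\mathrm{Der}(X)$ is the set of derangements of $X$. For $S\subseteq\mathrm{Sym}(X)$, $\langle S\rangle$ is the subgroup of $\mathrm{Sym}(X)$ generated by $S$. Sets may be infinite. A simple digraph is a pair $\Gamma=(X,A)$ with vertex set $X$ and arc set $A\subseteq\{(u,v): u,v\in X, u\neq v\}$. For non-empty $X$ and non-empty $S\subseteq \mathrm{Der}(X)$, the derangement action digraph $\overrightarrow{\mathrm{DA}}(X,S)$ is the simple digraph with vertex set $X$ and arc set $\{(x,x^s): x\in X, s\in S\}$. A simple digraph with vertex set $X$ is a derangement action digraph if it equals $\overrightarrow{\mathrm{DA}}(X,S)$ for some non-empty $S\subseteq \mathrm{Der}(X)$. For vertices $x,y$ of a simple digraph $\Gamma=(X,A)$, $x$ is connected to $y$ if either $x=y$ or there is a vertex sequence $v_0,v_1,\dots,v_r$ with $v_0=x$, $v_r=y$ and $(v_{i-1},v_i)\in A$ for $i=1,\dots,r$. This is the connectivity relation for $\Gamma$. If it is an equivalence relation, the sub-digraph induced on an equivalence class is called a connected component of $\Gamma$. *)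

theory Defs
  imports
    "HOL-Algebra.Generated_Groups"
    "HOL-Algebra.Group_Action"
    "Graph_Theory.Digraph_Component"
    "Graph_Theory.Pair_Digraph"
begin

section \<open>Permutations and derangements\<close>

text \<open>
  The symmetric group on \<open>X\<close> is \<open>BijGroup X\<close>; its elements are extensional functions, so
  that \<open>x\<^sup>s\<close> is \<open>s x\<close> and the restriction of \<open>s\<close> to an invariant set \<open>X'\<close> is
  \<open>restrict s X'\<close>. The product of \<open>BijGroup X\<close> is the opposite of the one for right actions;
  this affects neither the set of permutations in a generated subgroup nor its orbits.
\<close>

definition Der :: "'a set \<Rightarrow> ('a \<Rightarrow> 'a) set" where
  "Der X = {s \<in> carrier (BijGroup X). \<forall>x\<in>X. s x \<noteq> x}"

definition gen_orbits :: "'a set \<Rightarrow> ('a \<Rightarrow> 'a) set \<Rightarrow> 'a set set" where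
  "gen_orbits X S = orbits (subgroup_generated (BijGroup X) S) X (\<lambda>s. s)"

text \<open>
  The supports of the cycles of \<open>s\<close> are the orbits of the cyclic group generated by \<open>s\<close>
  (so an infinite cycle extends in both directions).
\<close>

definition cycles :: "'a set \<Rightarrow> ('a \<Rightarrow> 'a) \<Rightarrow> 'a set set" where
  "cycles X s = gen_orbits X {s}"


section \<open>Digraphs\<close>

text \<open>
  A simple digraph is a \<open>pair_pre_digraph\<close> satisfying \<open>pair_loopfree_digraph\<close>: arcs
  are pairs of distinct vertices, and no finiteness is imposed.
\<close>

definition DA :: "'a set \<Rightarrow> ('a \<Rightarrow> 'a) set \<Rightarrow> 'a pair_pre_digraph" where
  "DA X S = \<lparr>pverts = X, parcs = {(x, s x) | x s. x \<in> X \<and> s \<in> S}\<rparr>"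

definition derangement_action_digraph :: "'a pair_pre_digraph \<Rightarrow> bool" where
  "derangement_action_digraph \<Gamma> \<longleftrightarrow>
     pverts \<Gamma> \<noteq> {} \<and> (\<exists>S. S \<noteq> {} \<and> S \<subseteq> Der (pverts \<Gamma>) \<and> \<Gamma> = DA (pverts \<Gamma>) S)"

definition connectivity :: "'a pair_pre_digraph \<Rightarrow> 'a rel" where
  "connectivity \<Gamma> = {(x, y). x \<rightarrow>\<^sup>*\<^bsub>with_proj \<Gamma>\<^esub> y}"

definition induced :: "'a pair_pre_digraph \<Rightarrow> 'a set \<Rightarrow> 'a pair_pre_digraph" where
  "induced \<Gamma> C = \<lparr>pverts = C, parcs = {e \<in> parcs \<Gamma>. fst e \<in> C \<and> snd e \<in> C}\<rparr>"

text \<open>Meaningful only if \<open>connectivity \<Gamma>\<close> is an equivalence relation.\<close>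

definition connected_components :: "'a pair_pre_digraph \<Rightarrow> 'a pair_pre_digraph set" where
  "connected_components \<Gamma> = induced \<Gamma> ` (pverts \<Gamma> // connectivity \<Gamma>)"


section \<open>Sanity checks\<close>

lemma with_proj_induced: "with_proj (induced \<Gamma> C) = induce_subgraph (with_proj \<Gamma>) C"
  by (simp add: with_proj_def induced_def induce_subgraph_def)

lemma pair_loopfree_DA:
  assumes "S \<subseteq> Der X"
  shows "pair_loopfree_digraph (DA X S)"
proof
  fix e assume "e \<in> parcs (DA X S)"
  then obtain x s where e: "e = (x, s x)" "x \<in> X" "s \<in> S"
    by (auto simp: DA_def)
  then have "s \<in> Bij X" "s x \<noteq> x"
    using assms by (auto simp: Der_def BijGroup_def)
  then have "s x \<in> X"
    using e(2) Bij_imp_funcset by blast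
  then show "fst e \<in> pverts (DA X S)" "snd e \<in> pverts (DA X S)" "fst e \<noteq> snd e"
    using e \<open>s x \<noteq> x\<close> by (auto simp: DA_def)
qed

lemma connectivity_iff_vertex_sequence:
  assumes "pair_wf_digraph \<Gamma>"
  shows "(x, y) \<in> connectivity \<Gamma> \<longleftrightarrow> x \<in> pverts \<Gamma> \<and> y \<in> pverts \<Gamma> \<and>
    (x = y \<or> (\<exists>(r::nat) v. v 0 = x \<and> v r = y \<and> (\<forall>i\<in>{1..r}. (v (i - 1), v i) \<in> parcs \<Gamma>)))"
    (is "_ \<longleftrightarrow> ?R")
proof
  assume "(x, y) \<in> connectivity \<Gamma>"
  then have *: "(x, y) \<in> rtrancl_on (pverts \<Gamma>) (parcs \<Gamma>)"
    by (simp add: connectivity_def reachable_def)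
  have "(x, y) \<in> (parcs \<Gamma>)\<^sup>*"
    using * by (induction) (auto intro: rtrancl_into_rtrancl)
  then obtain r where "(x, y) \<in> parcs \<Gamma> ^^ r"
    using rtrancl_imp_relpow by blast
  then obtain v where "v 0 = x" "v r = y" "\<forall>i<r. (v i, v (Suc i)) \<in> parcs \<Gamma>"
    by (auto simp: relpow_fun_conv)
  moreover have "(v (i - 1), v i) \<in> parcs \<Gamma>" if "i \<in> {1..r}" for i
    using that calculation(3) by (cases i) auto
  ultimately show ?R
    using in_rtrancl_on_in_F[OF *] by (intro conjI disjI2 exI[of _ r] exI[of _ v] ballI)
next
  assume R: ?R
  then have "(x, y) \<in> (parcs \<Gamma>)\<^sup>*"
  proof (elim conjE disjE exE)
    fix r and v :: "nat \<Rightarrow> 'a"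
    assume v: "v 0 = x" "v r = y" "\<forall>i\<in>{1..r}. (v (i - 1), v i) \<in> parcs \<Gamma>"
    have "(v i, v (Suc i)) \<in> parcs \<Gamma>" if "i < r" for i
      using v(3)[rule_format, of "Suc i"] that by simp
    then show ?thesis
      using v(1,2) by (meson relpow_fun_conv relpow_imp_rtrancl)
  qed simp
  then have "(x, y) \<in> rtrancl_on (pverts \<Gamma>) (parcs \<Gamma>)"
  proof (induction)
    case base
    then show ?case using R by simp
  next
    case (step b c)
    then show ?case
      using pair_wf_digraph.in_arcsD2[OF assms] by (meson rtrancl_on_into_rtrancl_on)
  qed
  then show "(x, y) \<in> connectivity \<Gamma>"
    by (simp add: connectivity_def reachable_def)
qed

end

theory Submission
  imports Defs
begin

text \<open>
  For (a), the set of points of a finite cycle that are reachable from \<open>s x\<close> is mapped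
  injectively into itself by \<open>s\<close>, hence onto itself, so that it contains \<open>x\<close>: arcs can be
  traversed backwards. For (b), connectivity is always contained in the orbit relation of the
  generated group, and if it is symmetric then every generator and its inverse move points
  within their class. For (c), a family consisting of one derangement for each component
  glues to a derangement of the whole vertex set, and all such glued derangements together
  give the digraph.
\<close>

section \<open>Derangements and the connectivity relation\<close>

lemma Der_iff:
  "s \<in> Der X \<longleftrightarrow> s \<in> extensional X \<and> bij_betw s X X \<and> (\<forall>x\<in>X. s x \<noteq> x)"
  by (auto simp: Der_def BijGroup_def Bij_def)

lemma Der_in: "s \<in> Der X \<Longrightarrow> x \<in> X \<Longrightarrow> s x \<in> X"
  by (auto simp: Der_iff dest: bij_betwE)

lemma pverts_DA [simp]: "pverts (DA X S) = X"
  by (simp add: DA_def)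

lemma parcs_DA [simp]: "parcs (DA X S) = {(x, s x) | x s. x \<in> X \<and> s \<in> S}"
  by (simp add: DA_def)

lemma pverts_induced [simp]: "pverts (induced \<Gamma> C) = C"
  by (simp add: induced_def)

lemma parcs_induced [simp]:
  "parcs (induced \<Gamma> C) = {e \<in> parcs \<Gamma>. fst e \<in> C \<and> snd e \<in> C}"
  by (simp add: induced_def)

text \<open>Reachability unfolds to \<open>rtrancl_on\<close>, whose reflexivity is limited to the
  vertex set; this makes the relation reflexive on the vertices and keeps it inside their
  square.\<close>

lemma connectivity_rtrancl_on:
  "connectivity \<Gamma> = rtrancl_on (pverts \<Gamma>) (parcs \<Gamma>)"
  by (simp add: connectivity_def reachable_def)

lemma trans_connectivity: "trans (connectivity \<Gamma>)"
  by (auto simp: connectivity_rtrancl_on intro: transI rtrancl_on_trans)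

lemma refl_on_connectivity: "refl_on (pverts \<Gamma>) (connectivity \<Gamma>)"
  by (auto simp: connectivity_rtrancl_on refl_on_def)

lemma arc_connectivity:
  "(x, y) \<in> parcs \<Gamma> \<Longrightarrow> x \<in> pverts \<Gamma> \<Longrightarrow> y \<in> pverts \<Gamma> \<Longrightarrow> (x, y) \<in> connectivity \<Gamma>"
  unfolding connectivity_rtrancl_on by (meson rtrancl_on_refl rtrancl_on_into_rtrancl_on)

lemma connectivity_subset: "connectivity \<Gamma> \<subseteq> pverts \<Gamma> \<times> pverts \<Gamma>"
  by (auto simp: connectivity_rtrancl_on dest: in_rtrancl_on_in_F)

lemma Der_arc_connectivity:
  assumes "S \<subseteq> Der X" "s \<in> S" "x \<in> X"
  shows "(x, s x) \<in> connectivity (DA X S)"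
  using assms Der_in[of s X x] by (intro arc_connectivity) auto

text \<open>A walk is turned around arc by arc, the reversed pieces being composed by transitivity,
  so symmetry needs checking on single arcs only.\<close>

lemma sym_connectivityI:
  assumes "\<And>x y. (x, y) \<in> parcs \<Gamma> \<Longrightarrow> x \<in> pverts \<Gamma> \<Longrightarrow> y \<in> pverts \<Gamma> \<Longrightarrow> (y, x) \<in> connectivity \<Gamma>"
  shows "sym (connectivity \<Gamma>)"
proof (rule symI)
  fix x y assume "(x, y) \<in> connectivity \<Gamma>"
  then have "(x, y) \<in> rtrancl_on (pverts \<Gamma>) (parcs \<Gamma>)"
    by (simp add: connectivity_rtrancl_on)
  then show "(y, x) \<in> connectivity \<Gamma>"
  proof (induction rule: rtrancl_on_induct)
    case base
    then show ?case by (simp add: connectivity_rtrancl_on)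
  next
    case (step y z)
    then show ?case using assms trans_connectivity by (meson transD)
  qed
qed

section \<open>Orbits of the generated group\<close>

abbreviation gen_perms :: "'a set \<Rightarrow> ('a \<Rightarrow> 'a) set \<Rightarrow> ('a \<Rightarrow> 'a) set" where
  "gen_perms X S \<equiv> generate (BijGroup X) S"

lemma Der_subset_carrier: "S \<subseteq> Der X \<Longrightarrow> S \<subseteq> carrier (BijGroup X)"
  by (auto simp: Der_def)

text \<open>\<open>subgroup_generated\<close> first intersects its generators with the carrier.
  Derangements already lie there, so orbits can be described by the inductive set
  \<open>generate\<close>, which comes with an induction rule.\<close>

lemma gen_orbits_eq:
  assumes "S \<subseteq> Der X"
  shows "gen_orbits X S = (\<lambda>x. (\<lambda>g. g x) ` gen_perms X S) ` X"
proof -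
  have "carrier (BijGroup X) \<inter> S = S"
    using Der_subset_carrier[OF assms] by blast
  then show ?thesis
    by (auto simp: gen_orbits_def orbits_def orbit_def carrier_subgroup_generated)
qed

lemma gen_perms_Bij:
  assumes "S \<subseteq> Der X" "g \<in> gen_perms X S"
  shows "g \<in> Bij X"
  using group.generate_in_carrier[OF group_BijGroup Der_subset_carrier[OF assms(1)] assms(2)]
  by (simp add: BijGroup_def)

lemma orbit_refl:
  assumes "x \<in> X"
  shows "x \<in> (\<lambda>g. g x) ` gen_perms X S"
proof (rule image_eqI)
  \<comment> \<open>The unit of \<open>BijGroup X\<close> is the identity restricted to
    \<open>X\<close>, hence the appeal to \<open>x \<in> X\<close>.\<close>
  show "x = \<one>\<^bsub>BijGroup X\<^esub> x"
    using assms by (simp add: BijGroup_def)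
qed (rule generate.one)

text \<open>The product of \<open>BijGroup X\<close> applies its right factor first, so multiplying
  by \<open>s\<close> on the left moves the image of \<open>x\<close> one arc further.\<close>

lemma orbit_step:
  assumes "S \<subseteq> Der X" "x \<in> X" "s \<in> S" "y \<in> (\<lambda>g. g x) ` gen_perms X S"
  shows "s y \<in> (\<lambda>g. g x) ` gen_perms X S"
proof -
  obtain g where g: "g \<in> gen_perms X S" "y = g x"
    using assms(4) by blast
  have "s \<in> Bij X"
    using Der_subset_carrier assms(1,3) by (auto simp: BijGroup_def)
  then have "s y = (s \<otimes>\<^bsub>BijGroup X\<^esub> g) x"
    using g(2) gen_perms_Bij[OF assms(1) g(1)] assms(2) by (simp add: BijGroup_def compose_eq)
  then show ?thesis
    using generate.eng[OF generate.incl[OF assms(3)] g(1)] by blast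
qed

text \<open>The labels along a walk multiply to an element of the generated group. No inverses
  occur, so this inclusion does not depend on symmetry of connectivity.\<close>

lemma connectivity_imp_orbit:
  assumes "S \<subseteq> Der X" "(x, y) \<in> connectivity (DA X S)"
  shows "y \<in> (\<lambda>g. g x) ` gen_perms X S"
proof -
  have x: "x \<in> X"
    using assms(2) connectivity_subset by fastforce
  have "(x, y) \<in> rtrancl_on X (parcs (DA X S))"
    using assms(2) by (simp add: connectivity_rtrancl_on)
  then show ?thesis
  proof (induction rule: rtrancl_on_induct)
    case base
    then show ?case by (rule orbit_refl)
  next
    case (step y z)
    then obtain s where "s \<in> S" "z = s y"
      by auto
    then show ?case
      using orbit_step[OF assms(1) x _ step.IH] by simp
  qed
qed

text \<open>Induction on the construction of \<open>g\<close>. Inverses are where walks alone do not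
  suffice and symmetry enters.\<close>

lemma orbit_imp_connectivity:
  assumes S: "S \<subseteq> Der X" and R: "equiv X (connectivity (DA X S))"
    and "g \<in> gen_perms X S" "x \<in> X"
  shows "(x, g x) \<in> connectivity (DA X S)"
  using assms(3,4)
proof (induction arbitrary: x)
  case one
  then show ?case
    using R by (simp add: BijGroup_def equiv_def refl_on_def)
next
  case (incl h)
  then show ?case
    using S by (intro Der_arc_connectivity)
next
  case (inv h)
  then have h: "h \<in> Bij X"
    using Der_subset_carrier[OF S] by (auto simp: BijGroup_def)
  \<comment> \<open>The preimage of \<open>x\<close> has an arc to \<open>x\<close>, and symmetry
    reverses it.\<close>
  let ?z = "inv_into X h x"
  have "?z \<in> X" "h ?z = x"
    using h inv.prems by (auto simp: Bij_def bij_betw_def inv_into_into f_inv_into_f)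
  then have "(?z, x) \<in> connectivity (DA X S)"
    using Der_arc_connectivity[OF S inv.hyps, of ?z] by simp
  then have "(x, ?z) \<in> connectivity (DA X S)"
    using R by (meson equivE symD)
  then show ?case
    using h inv.prems by (simp add: inv_BijGroup)
next
  case (eng g h)
  have gh: "g \<in> Bij X" "h \<in> Bij X"
    using gen_perms_Bij[OF S] eng.hyps by auto
  then have "h x \<in> X"
    using eng.prems Bij_imp_funcset by blast
  \<comment> \<open>The hypothesis for \<open>g\<close> is used at \<open>h x\<close>, which is why
    the induction leaves \<open>x\<close> arbitrary.\<close>
  then have "(x, g (h x)) \<in> connectivity (DA X S)"
    using eng.IH eng.prems trans_connectivity by (meson transD)
  then show ?case
    using gh eng.prems by (simp add: BijGroup_def compose_eq)
qed

lemma connectivity_classes_eq_orbits: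
  assumes "S \<subseteq> Der X" "equiv X (connectivity (DA X S))"
  shows "X // connectivity (DA X S) = gen_orbits X S"
proof -
  have "connectivity (DA X S) `` {x} = (\<lambda>g. g x) ` gen_perms X S" if "x \<in> X" for x
    using that connectivity_imp_orbit[OF assms(1)] orbit_imp_connectivity[OF assms] by blast
  then show ?thesis
    by (auto simp: gen_orbits_eq[OF assms(1)] quotient_def)
qed

section \<open>Finite cycles and symmetry of connectivity\<close>

lemma equiv_connectivity_if_finite_cycles:
  assumes S: "S \<subseteq> Der X" and fin: "\<forall>s\<in>S. \<forall>C\<in>cycles X s. finite C"
  shows "equiv X (connectivity (DA X S))"
proof (rule equivI)
  let ?R = "connectivity (DA X S)"
  show "?R \<subseteq> X \<times> X" "refl_on X ?R" "trans ?R"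
    using connectivity_subset[of "DA X S"] refl_on_connectivity[of "DA X S"] trans_connectivity
    by auto
  show "sym ?R"
  proof (rule sym_connectivityI)
    fix x y assume "(x, y) \<in> parcs (DA X S)"
    then obtain s where s: "s \<in> S" "y = s x" and x: "x \<in> X"
      by auto
    then have sD: "s \<in> Der X" "{s} \<subseteq> Der X"
      using S by auto
    \<comment> \<open>\<open>C\<close> is the cycle of \<open>s\<close> through
      \<open>x\<close>.\<close>
    define C where "C = (\<lambda>g. g x) ` gen_perms X {s}"
    have "C \<in> cycles X s"
      using x by (auto simp: cycles_def gen_orbits_eq[OF sD(2)] C_def)
    then have "finite C"
      using fin s by blast
    have "x \<in> C"
      using x unfolding C_def by (rule orbit_refl)
    have C_step: "s z \<in> C" if "z \<in> C" for z
      using that orbit_step[OF sD(2) x] unfolding C_def by blast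
    have "C \<subseteq> X"
      using gen_perms_Bij[OF sD(2)] Bij_imp_funcset x unfolding C_def by blast
    \<comment> \<open>Reachability from \<open>s x\<close> may use arcs of all of \<open>S\<close>;
      only the cycle \<open>C\<close> belongs to \<open>s\<close> alone, and it bounds
      \<open>A\<close> by a finite set.\<close>
    define A where "A = C \<inter> ?R `` {s x}"
    have "s ` A \<subseteq> A"
    proof (rule image_subsetI)
      fix z assume "z \<in> A"
      then have z: "z \<in> C" "(s x, z) \<in> ?R"
        by (simp_all add: A_def)
      then have "(z, s z) \<in> ?R"
        using Der_arc_connectivity[OF S s(1)] \<open>C \<subseteq> X\<close> by blast
      then have "(s x, s z) \<in> ?R"
        using z(2) trans_connectivity by (meson transD)
      then show "s z \<in> A"
        using C_step[OF z(1)] by (simp add: A_def)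
    qed
    moreover have inj: "inj_on s X"
      using sD(1) by (auto simp: Der_iff bij_betw_def)
    moreover have "A \<subseteq> X" "finite A"
      using \<open>C \<subseteq> X\<close> \<open>finite C\<close> by (auto simp: A_def)
    \<comment> \<open>An injective self-map of a finite set is onto.\<close>
    ultimately have "s ` A = A"
      by (meson endo_inj_surj inj_on_subset)
    moreover have "s x \<in> A"
      using C_step[OF \<open>x \<in> C\<close>] \<open>C \<subseteq> X\<close> refl_onD[OF refl_on_connectivity[of "DA X S"], of "s x"]
      by (simp add: A_def subset_iff)
    ultimately have "s x \<in> s ` A"
      by simp
    \<comment> \<open>Injectivity of \<open>s\<close> on all of \<open>X\<close> rules out any
      preimage of \<open>s x\<close> other than \<open>x\<close>.\<close>
    then have "x \<in> A"
      using inj_on_image_mem_iff[OF inj x \<open>A \<subseteq> X\<close>] by simp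
    then show "(y, x) \<in> ?R"
      by (simp add: A_def s(2))
  qed
qed

section \<open>Restricting derangements to a class\<close>

text \<open>Each \<open>x\<close> is related to \<open>s x\<close> in both directions, so
  \<open>s\<close> neither leaves nor enters the class. Surjectivity comes from this and not from
  counting, as \<open>C\<close> may be infinite.\<close>

lemma restrict_Der_class:
  assumes S: "S \<subseteq> Der X" and R: "equiv X (connectivity (DA X S))"
    and C: "C \<in> X // connectivity (DA X S)" and "s \<in> S"
  shows "restrict s C \<in> Der C"
proof -
  have s: "bij_betw s X X" "\<forall>x\<in>X. s x \<noteq> x"
    using assms(1,4) by (auto simp: Der_iff)
  have "C \<subseteq> X"
    using R C in_quotient_imp_subset by (blast elim: equivE)
  have arc: "(x, s x) \<in> connectivity (DA X S)" if "x \<in> X" for x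
    using Der_arc_connectivity[OF S \<open>s \<in> S\<close> that] .
  have "sym (connectivity (DA X S))"
    using R by (rule equivE)
  have iff: "s x \<in> C \<longleftrightarrow> x \<in> C" if "x \<in> X" for x
    using in_quotient_imp_closed[OF R C] arc[OF that] symD[OF \<open>sym _\<close> arc[OF that]] by blast
  have "s ` C = C"
  proof
    show "C \<subseteq> s ` C"
    proof
      fix y assume "y \<in> C"
      then obtain x where "x \<in> X" "y = s x"
        using s(1) \<open>C \<subseteq> X\<close> by (auto simp: bij_betw_def)
      then show "y \<in> s ` C"
        using iff \<open>y \<in> C\<close> by blast
    qed
  qed (use iff \<open>C \<subseteq> X\<close> in blast)
  then have "bij_betw s C C"
    using inj_on_subset[OF bij_betw_imp_inj_on[OF s(1)] \<open>C \<subseteq> X\<close>] by (simp add: bij_betw_def)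
  then have "bij_betw (restrict s C) C C"
    by (simp cong: bij_betw_cong)
  then show ?thesis
    using s(2) \<open>C \<subseteq> X\<close> by (auto simp: Der_iff)
qed

text \<open>Arcs starting in \<open>C\<close> also end in \<open>C\<close>, so inducing only
  restricts the tails, and there \<open>s\<close> agrees with its restriction.\<close>

lemma induced_DA_class:
  assumes S: "S \<subseteq> Der X" and R: "equiv X (connectivity (DA X S))"
    and C: "C \<in> X // connectivity (DA X S)"
  shows "induced (DA X S) C = DA C ((\<lambda>s. restrict s C) ` S)"
proof -
  have "C \<subseteq> X"
    using R C in_quotient_imp_subset by (blast elim: equivE)
  moreover have "s x \<in> C" if "s \<in> S" "x \<in> C" for s x
    using Der_in[OF restrict_Der_class[OF S R C that(1)] that(2)] that(2) by simp
  ultimately have "parcs (induced (DA X S) C) = {(x, s x) | x s. x \<in> C \<and> s \<in> S}"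
    by auto
  also have "\<dots> = {(x, restrict s C x) | x s. x \<in> C \<and> s \<in> S}"
    by (metis (lifting) restrict_apply')
  also have "\<dots> = parcs (DA C ((\<lambda>s. restrict s C) ` S))"
    unfolding parcs_DA by blast
  finally show ?thesis
    by (intro pair_pre_digraph.equality) auto
qed

lemma components_of_derangement_action_digraph:
  assumes "derangement_action_digraph \<Gamma>" "equiv (pverts \<Gamma>) (connectivity \<Gamma>)"
    and "\<Delta> \<in> connected_components \<Gamma>"
  shows "derangement_action_digraph \<Delta>"
proof -
  obtain X S where S: "S \<noteq> {}" "S \<subseteq> Der X" and \<Gamma>: "\<Gamma> = DA X S"
    using assms(1) unfolding derangement_action_digraph_def by metis
  have R: "equiv X (connectivity (DA X S))"
    using assms(2) unfolding \<Gamma> pverts_DA .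
  obtain C where C: "C \<in> X // connectivity (DA X S)" "\<Delta> = induced (DA X S) C"
    using assms(3) unfolding connected_components_def \<Gamma> pverts_DA by (rule imageE)
  have "C \<noteq> {}"
    using R C(1) in_quotient_imp_non_empty by blast
  moreover have "(\<lambda>s. restrict s C) ` S \<subseteq> Der C" "(\<lambda>s. restrict s C) ` S \<noteq> {}"
    using S(1) restrict_Der_class[OF S(2) R C(1)] by blast+
  ultimately show ?thesis
    unfolding derangement_action_digraph_def C(2) induced_DA_class[OF S(2) R C(1)] pverts_DA
    by (intro conjI exI[of _ "(\<lambda>s. restrict s C) ` S"] refl)
qed

section \<open>Gluing derangements along classes\<close>

text \<open>Every point stays in its class, so injectivity, surjectivity and freeness from fixed
  points can each be checked inside one class. The restriction to \<open>X\<close> makes the glued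
  map extensional.\<close>

lemma glue_Der:
  assumes R: "equiv X R" and t: "\<And>C. C \<in> X // R \<Longrightarrow> t C \<in> Der C"
  shows "(\<lambda>x\<in>X. t (R `` {x}) x) \<in> Der X"
proof -
  let ?s = "\<lambda>x. t (R `` {x}) x"
  have t': "t (R `` {x}) \<in> Der (R `` {x})" if "x \<in> X" for x
    using t that by (simp add: quotientI)
  have self: "x \<in> R `` {x}" if "x \<in> X" for x
    using equiv_class_self[OF R that] .
  have mem: "?s x \<in> R `` {x}" if "x \<in> X" for x
    using Der_in[OF t'[OF that] self[OF that]] .
  have sub: "R `` {x} \<subseteq> X" for x
    using R by (auto elim: equivE)
  have "inj_on ?s X"
  proof (rule inj_onI)
    fix x y assume xy: "x \<in> X" "y \<in> X" "?s x = ?s y"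
    have "(x, ?s x) \<in> R" "(y, ?s y) \<in> R"
      using mem[OF xy(1)] mem[OF xy(2)] by blast+
    \<comment> \<open>Points with a common image share a class, where a single injective map acts on
      both.\<close>
    then have eq: "R `` {x} = R `` {y}"
      using equiv_class_eq[OF R] xy(3) by metis
    have "inj_on (t (R `` {x})) (R `` {x})"
      using t'[OF xy(1)] by (simp add: Der_iff bij_betw_def)
    moreover have "y \<in> R `` {x}"
      using self[OF xy(2)] eq by blast
    ultimately show "x = y"
      using xy(3) self[OF xy(1)] unfolding eq[symmetric] by (meson inj_onD)
  qed
  moreover have "?s ` X \<subseteq> X"
    using mem sub by blast
  moreover have "X \<subseteq> ?s ` X"
  proof
    fix y assume y: "y \<in> X"
    have "t (R `` {y}) ` (R `` {y}) = R `` {y}"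
      using t'[OF y] by (simp add: Der_iff bij_betw_def)
    then obtain x where x: "x \<in> R `` {y}" "y = t (R `` {y}) x"
      using self[OF y] by (metis imageE)
    then have "R `` {y} = R `` {x}"
      using equiv_class_eq[OF R] by blast
    then have "y = ?s x"
      using x(2) by argo
    then show "y \<in> ?s ` X"
      using x(1) sub by blast
  qed
  ultimately have "bij_betw ?s X X"
    by (auto simp: bij_betw_def)
  then have "bij_betw (restrict ?s X) X X"
    by (simp cong: bij_betw_cong)
  moreover have "?s x \<noteq> x" if "x \<in> X" for x
    using t'[OF that] self[OF that] unfolding Der_iff by blast
  ultimately show ?thesis
    by (simp add: Der_iff)
qed

lemma derangement_action_digraph_if_components:
  assumes "pair_wf_digraph \<Gamma>" and ne: "pverts \<Gamma> \<noteq> {}"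
    and equiv: "equiv (pverts \<Gamma>) (connectivity \<Gamma>)"
    and comp: "\<forall>\<Delta>\<in>connected_components \<Gamma>. derangement_action_digraph \<Delta>"
  shows "derangement_action_digraph \<Gamma>"
proof -
  interpret pair_wf_digraph \<Gamma> by fact
  define X where "X = pverts \<Gamma>"
  define R where "R = connectivity \<Gamma>"
  have R: "equiv X R"
    using equiv by (simp add: X_def R_def)
  have "\<forall>C\<in>X // R. \<exists>T. T \<noteq> {} \<and> T \<subseteq> Der C \<and> induced \<Gamma> C = DA C T"
    using comp by (auto simp: connected_components_def derangement_action_digraph_def X_def R_def)
  then obtain T where T: "\<And>C. C \<in> X // R \<Longrightarrow> T C \<noteq> {}" "\<And>C. C \<in> X // R \<Longrightarrow> T C \<subseteq> Der C"
    "\<And>C. C \<in> X // R \<Longrightarrow> induced \<Gamma> C = DA C (T C)"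
    by metis
  define glue where "glue t = (\<lambda>x\<in>X. t (R `` {x}) x)" for t :: "'a set \<Rightarrow> 'a \<Rightarrow> 'a"
  \<comment> \<open>All choice functions are glued; their values outside \<open>X // R\<close> are
    never read by \<open>glue\<close> on \<open>X\<close>.\<close>
  define S where "S = glue ` {t. \<forall>C\<in>X // R. t C \<in> T C}"
  have "\<forall>C\<in>X // R. \<exists>u. u \<in> T C"
    using T(1) by blast
  \<comment> \<open>There may be infinitely many classes, so this uses choice. \<open>t0\<close>
    shows that \<open>S\<close> is non-empty and later fills in the classes away from a given
    arc.\<close>
  then obtain t0 where t0: "\<forall>C\<in>X // R. t0 C \<in> T C"
    by (rule bchoice[THEN exE])
  have "S \<noteq> {}"
    using t0 by (auto simp: S_def)
  moreover have "S \<subseteq> Der X"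
    unfolding S_def glue_def
  proof (rule image_subsetI)
    fix t assume t: "t \<in> {t. \<forall>C\<in>X // R. t C \<in> T C}"
    show "(\<lambda>x\<in>X. t (R `` {x}) x) \<in> Der X"
      by (rule glue_Der[OF R]) (use t T(2) in blast)
  qed
  moreover have "parcs \<Gamma> = parcs (DA X S)"
  proof (intro equalityI subrelI)
    fix x y assume xy: "(x, y) \<in> parcs \<Gamma>"
    then have x: "x \<in> X" and y: "y \<in> X"
      using in_arcsD1 in_arcsD2 by (auto simp: X_def)
    let ?C = "R `` {x}"
    \<comment> \<open>The two ends of an arc are connected, so every arc of \<open>\<Gamma>\<close>
      survives in some component.\<close>
    have "(x, y) \<in> R"
      using xy x y by (simp add: R_def X_def arc_connectivity)
    then have "?C \<in> X // R" "x \<in> ?C" "y \<in> ?C"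
      using x equiv_class_self[OF R] by (simp_all add: quotientI)
    then have "(x, y) \<in> parcs (DA ?C (T ?C))"
      using xy unfolding T(3)[OF \<open>?C \<in> X // R\<close>, symmetric] by simp
    then obtain u where u: "u \<in> T ?C" "y = u x"
      by auto
    \<comment> \<open>Changing \<open>t0\<close> at one class only extends \<open>u\<close> to a
      glued derangement that realises the arc.\<close>
    let ?t = "t0(?C := u)"
    have "glue ?t \<in> S"
      using t0 u(1) by (auto simp: S_def)
    moreover have "glue ?t x = y"
      using u(2) x by (simp add: glue_def)
    ultimately show "(x, y) \<in> parcs (DA X S)"
      using x unfolding parcs_DA by blast
  next
    fix x y assume "(x, y) \<in> parcs (DA X S)"
    then obtain t where t: "\<forall>C\<in>X // R. t C \<in> T C" and x: "x \<in> X" and y: "y = glue t x"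
      by (auto simp: S_def)
    let ?C = "R `` {x}"
    have C: "?C \<in> X // R" "x \<in> ?C"
      using x equiv_class_self[OF R] by (auto simp: quotientI)
    then have "(x, y) \<in> parcs (DA ?C (T ?C))"
      using t x y unfolding parcs_DA glue_def by auto
    then show "(x, y) \<in> parcs \<Gamma>"
      unfolding T(3)[OF C(1), symmetric] by simp
  qed
  then have "\<Gamma> = DA X S"
    by (intro pair_pre_digraph.equality) (auto simp: X_def)
  ultimately show ?thesis
    using ne unfolding derangement_action_digraph_def X_def by blast
qed

theorem theorem1p13:
  fixes X :: "'a set" and S :: "('a \<Rightarrow> 'a) set"
  assumes "X \<noteq> {}" and "S \<noteq> {}" and "S \<subseteq> Der X"
  shows
    "((\<forall>s\<in>S. \<forall>C\<in>cycles X s. finite C) \<longrightarrow> equiv X (connectivity (DA X S)))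
     \<and>
     (equiv X (connectivity (DA X S)) \<longrightarrow>
        X // connectivity (DA X S) = gen_orbits X S \<and>
        (\<forall>X'\<in>gen_orbits X S.
           (\<lambda>s. restrict s X') ` S \<subseteq> Der X' \<and>
           induced (DA X S) X' = DA X' ((\<lambda>s. restrict s X') ` S)))
     \<and>
     (\<forall>\<Gamma> :: 'b pair_pre_digraph.
        pair_loopfree_digraph \<Gamma> \<and> pverts \<Gamma> \<noteq> {} \<and> equiv (pverts \<Gamma>) (connectivity \<Gamma>) \<longrightarrow>
        (derangement_action_digraph \<Gamma> \<longleftrightarrow>
           (\<forall>\<Delta>\<in>connected_components \<Gamma>. derangement_action_digraph \<Delta>)))"
proof (intro conjI impI allI ballI)
  show "equiv X (connectivity (DA X S))" if "\<forall>s\<in>S. \<forall>C\<in>cycles X s. finite C"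
    using equiv_connectivity_if_finite_cycles[OF assms(3) that] .
next
  assume R: "equiv X (connectivity (DA X S))"
  show classes: "X // connectivity (DA X S) = gen_orbits X S"
    using connectivity_classes_eq_orbits[OF assms(3) R] .
  fix X' assume "X' \<in> gen_orbits X S"
  \<comment> \<open>Orbits are now known to be classes, the form in which the restriction results
    apply.\<close>
  then have X': "X' \<in> X // connectivity (DA X S)"
    by (simp add: classes)
  show "(\<lambda>s. restrict s X') ` S \<subseteq> Der X'"
    using restrict_Der_class[OF assms(3) R X'] by blast
  show "induced (DA X S) X' = DA X' ((\<lambda>s. restrict s X') ` S)"
    using induced_DA_class[OF assms(3) R X'] .
next
  fix \<Gamma> :: "'b pair_pre_digraph"
  assume "pair_loopfree_digraph \<Gamma> \<and> pverts \<Gamma> \<noteq> {} \<and> equiv (pverts \<Gamma>) (connectivity \<Gamma>)"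
  then show "derangement_action_digraph \<Gamma> \<longleftrightarrow>
      (\<forall>\<Delta>\<in>connected_components \<Gamma>. derangement_action_digraph \<Delta>)"
    using components_of_derangement_action_digraph derangement_action_digraph_if_components
      pair_loopfree_digraph.axioms(1)
    by metis
qed

end
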